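(* Suppose $D$ is an MBQC-form diagram that contains a full spider nest on $n$ qubits with phase $2\pi$, and let $D'$ be the diagram without that spider nest (i.e. with all the phase gadgets of the nest and their incident edges deleted). Then the two diagrams represent the same linear operation (up to a non-zero scalar), and $D'$ has extended causal flow whenever $D$ has extended causal flow. Similarly, $D'$ has gflow whenever $D$ has gflow, and $D'$ has Pauli flow whenever $D$ has Pauli flow.
   Context: An MBQC-form diagram consists of a finite simple undirected graph $G=(V,E)$, inputs $I\subseteq V$, outputs $O\subseteq V$, and for each $v\in V\setminus O$ a measurement effect $e_v$ (a row vector, considered up to non-zero scalar) of one of the following types: $XY$ with angle $\alpha\in\mathbb R$: $\langle0|+e^{i\alpha}\langle1|$; $YZ$ with angle $\alpha$: $\langle+|+e^{i\alpha}\langle-|$; $XZ$ with angle $\alpha$: $(\langle+|+e^{i\alpha}\langle-|)\circ\mathrm{diag}(1,i)$; $X$: as $XY$ with $\alpha\in\{0,\pi\}$; $Y$: as $XY$ with $\alpha=\pm\pi/2$; $Z$: as $YZ$ with $\alpha\in\{0,\pi\}$. The interpretation, up to non-zero scalar, is the linear map $(\mathbb C^2)^{\otimes I}\to(\mathbb C^2)^{\otimes O}$, $|x\rangle\mapsto\sum_{y\in\{0,1\}^V,\,y|_I=x}(-1)^{|\{\{u,v\}\in E:\,y_u=y_v=1\}|}\big(\prod_{v\in V\setminus O}e_v|y_v\rangle\big)|y|_O\rangle$. Phase gadgets and spider nests: a phase gadget with phase $\alpha$ is a non-input vertex whose effect is the $YZ$ effect with angle $\alpha$. A full spider nest on $n\ge1$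 qubits with phase $\varphi$ consists, for given distinct vertices $v_1,\dots,v_n$ (the qubits), of $2^n-1$ further distinct phase gadgets $g_s$, one for each $s\in\{0,1\}^n\setminus\{00\ldots0\}$, where $g_s$ has neighbourhood exactly $\{v_k: s_k=1\}$ and phase $\alpha_s=(-1)^{|s|-1}\frac{\varphi}{2^{n-1}}$, with $|s|$ the Hamming weight of $s$. A labelled open graph is a tuple $(G,I,O,\lambda)$ with $\lambda:V\setminus O\to\{X,Y,Z,XY,XZ,YZ\}$. Labels $X,Y,Z$ are called Pauli, and $XY,XZ,YZ$ planar. It corresponds to a diagram if $G,I,O$ agree and each effect $e_v$ is, up to scalar, an effect of type $\lambda(v)$ for some allowed angle. If some angles are integer multiples of $\pi/2$, several labelled open graphs, differing only in $\lambda$, correspond to the same diagram; among them there is a unique one with the maximum number of Pauli labels. Flow of labelled open graphs: write $\overline S=V\setminus S$; $\mathrm{Odd}_G(S)$ is the set of vertices with an odd number of neighbours in $S$; $\mathrm{Odd}_G[S]=\mathrm{Odd}_G(S)\,\triangle\,S$. For $c:\overline O\to\mathcal P(\overline I)$ let $R_c$ be the set of pairs $(u,v)$, $u\neq v$, with: $v\in c(u)$ and $\lambda(v)\notin\{X,Y\}$; or $v\in\mathrm{Odd}_G(c(u))$ and $\lambda(v)\notin\{Y,Z\}$; or $v\in\mathrm{Odd}_G[c(u)]$ and $\lambda(v)=Y$ (for $v\in O$ the "$\notin$" conditions count as satisfied). $(G,I,O,\lambda)$ has Pauli flow if there is $p:\overline O\to\mathcal P(\overline I)$ such that the transitive closure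 of $R_p$ is a strict partial order and for all $u\in\overline O$, according to $\lambda(u)$: $XY$: $u\notin p(u)$, $u\in\mathrm{Odd}_G(p(u))$; $XZ$: $u\in p(u)$, $u\in\mathrm{Odd}_G(p(u))$; $YZ$: $u\in p(u)$, $u\notin\mathrm{Odd}_G(p(u))$; $X$: $u\in\mathrm{Odd}_G(p(u))$; $Z$: $u\in p(u)$; $Y$: $u\in\mathrm{Odd}_G[p(u)]$. If all labels are planar, a Pauli flow is called a gflow. If all labels are in $\{XY,YZ\}$, an extended causal flow is a map $f:\overline O\to\overline I$ such that the transitive closure of $R_f$ (identifying $f(v)$ with $\{f(v)\}$) is a strict partial order and for all $v\in\overline O$: if $\lambda(v)=XY$ then $f(v)$ is adjacent to $v$, and if $\lambda(v)=YZ$ then $f(v)=v$. Flow of diagrams: an MBQC-form diagram has Pauli flow if the corresponding labelled open graph with the maximum number of Pauli labels has Pauli flow; it has gflow if there exists a corresponding labelled open graph with all labels planar which has gflow; it has extended causal flow if there exists a corresponding labelled open graph with all labels in $\{XY,YZ\}$ which has extended causal flow. *)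

theory Defs
  imports Complex_Main "HOL-Library.FuncSet"
begin

section \<open>Open graphs\<close>

text \<open>Edges are two-element sets of vertices.\<close>

record 'v open_graph =
  verts :: "'v set"
  edges :: "'v set set"
  inputs :: "'v set"
  outputs :: "'v set"

definition wf_open_graph :: "('v, 'b) open_graph_scheme \<Rightarrow> bool" where
  "wf_open_graph G \<longleftrightarrow>
     finite (verts G) \<and>
     edges G \<subseteq> {{u, w} |u w. u \<in> verts G \<and> w \<in> verts G \<and> u \<noteq> w} \<and>
     inputs G \<subseteq> verts G \<and> outputs G \<subseteq> verts G"

definition non_inputs :: "('v, 'b) open_graph_scheme \<Rightarrow> 'v set" where
  "non_inputs G = verts G - inputs G"

definition non_outputs :: "('v, 'b) open_graph_scheme \<Rightarrow> 'v set" where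
  "non_outputs G = verts G - outputs G"

definition neighbours :: "('v, 'b) open_graph_scheme \<Rightarrow> 'v \<Rightarrow> 'v set" where
  "neighbours G u = {w \<in> verts G. {u, w} \<in> edges G}"

definition odd_nbhd :: "('v, 'b) open_graph_scheme \<Rightarrow> 'v set \<Rightarrow> 'v set" where
  "odd_nbhd G S = {w \<in> verts G. odd (card (neighbours G w \<inter> S))}"

text \<open>\<open>Odd_G[S]\<close>, as opposed to \<open>Odd_G(S)\<close> above.\<close>

definition odd_nbhd_closed :: "('v, 'b) open_graph_scheme \<Rightarrow> 'v set \<Rightarrow> 'v set" where
  "odd_nbhd_closed G S = sym_diff (odd_nbhd G S) S"


section \<open>Measurement effects\<close>

datatype label = MX | MY | MZ | MXY | MXZ | MYZ

definition pauli :: "label set" where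
  "pauli = {MX, MY, MZ}"

definition planar :: "label set" where
  "planar = {MXY, MXZ, MYZ}"

text \<open>A row vector \<open>e\<close> on one qubit is a function on bits, where \<open>e b\<close> is the product of \<open>e\<close>
  with the basis ket \<open>b\<close>; \<open>False\<close> and \<open>True\<close> stand for 0 and 1.\<close>

type_synonym bra = "bool \<Rightarrow> complex"

definition bra_zero :: bra where
  "bra_zero b = (if b then 0 else 1)"

definition bra_one :: bra where
  "bra_one b = (if b then 1 else 0)"

definition bra_plus :: bra where
  "bra_plus b = (bra_zero b + bra_one b) / sqrt 2"

definition bra_minus :: bra where
  "bra_minus b = (bra_zero b - bra_one b) / sqrt 2"

definition effect_XY :: "real \<Rightarrow> bra" where
  "effect_XY \<alpha> b = bra_zero b + exp (\<i> * \<alpha>) * bra_one b"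

definition effect_YZ :: "real \<Rightarrow> bra" where
  "effect_YZ \<alpha> b = bra_plus b + exp (\<i> * \<alpha>) * bra_minus b"

text \<open>The last factor is the diagonal matrix with entries \<open>1, \<i>\<close>.\<close>

definition effect_XZ :: "real \<Rightarrow> bra" where
  "effect_XZ \<alpha> b = (bra_plus b + exp (\<i> * \<alpha>) * bra_minus b) * (if b then \<i> else 1)"

fun measurement_effect :: "label \<Rightarrow> real \<Rightarrow> bra" where
  "measurement_effect MX = effect_XY"
| "measurement_effect MY = effect_XY"
| "measurement_effect MZ = effect_YZ"
| "measurement_effect MXY = effect_XY"
| "measurement_effect MXZ = effect_XZ"
| "measurement_effect MYZ = effect_YZ"

fun allowed_angles :: "label \<Rightarrow> real set" where
  "allowed_angles MX = {0, pi}"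
| "allowed_angles MY = {pi / 2, - pi / 2}"
| "allowed_angles MZ = {0, pi}"
| "allowed_angles MXY = UNIV"
| "allowed_angles MXZ = UNIV"
| "allowed_angles MYZ = UNIV"

definition proportional :: "bra \<Rightarrow> bra \<Rightarrow> bool" where
  "proportional e e' \<longleftrightarrow> (\<exists>c. c \<noteq> 0 \<and> (\<forall>b. e b = c * e' b))"

definition has_type :: "bra \<Rightarrow> label \<Rightarrow> bool" where
  "has_type e l \<longleftrightarrow> (\<exists>\<alpha> \<in> allowed_angles l. proportional e (measurement_effect l \<alpha>))"


section \<open>MBQC-form diagrams and their interpretation\<close>

text \<open>Only the values of \<open>eff\<close> on non-outputs are meaningful, and these only up to a
  non-zero scalar: \<open>eff\<close> picks arbitrary representatives.\<close>

record 'v mbqc_diagram = "'v open_graph" +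
  eff :: "'v \<Rightarrow> bra"

definition wf_diagram :: "'v mbqc_diagram \<Rightarrow> bool" where
  "wf_diagram D \<longleftrightarrow> wf_open_graph D \<and> (\<forall>v \<in> non_outputs D. \<exists>l. has_type (eff D v) l)"

definition bitstrings :: "'v set \<Rightarrow> ('v \<Rightarrow> bool) set" where
  "bitstrings S = (S \<rightarrow>\<^sub>E UNIV)"

text \<open>A vector of the tensor product of one qubit per element of \<open>S\<close> is given by its
  coordinates with respect to the basis \<open>bitstrings S\<close>; coordinates at other arguments are
  ignored (as input) or zero (as output).\<close>

type_synonym 'v state = "('v \<Rightarrow> bool) \<Rightarrow> complex"

definition ket :: "('v \<Rightarrow> bool) \<Rightarrow> 'v state" where
  "ket x = (\<lambda>z. if z = x then 1 else 0)"

definition amplitude :: "'v mbqc_diagram \<Rightarrow> ('v \<Rightarrow> bool) \<Rightarrow> complex" where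
  "amplitude D y =
     (- 1) ^ card {e \<in> edges D. \<forall>u \<in> e. y u} * (\<Prod>v \<in> non_outputs D. eff D v (y v))"

definition interp_ket :: "'v mbqc_diagram \<Rightarrow> ('v \<Rightarrow> bool) \<Rightarrow> 'v state" where
  "interp_ket D x = (\<lambda>z.
     \<Sum>y \<in> {y \<in> bitstrings (verts D). restrict y (inputs D) = x}.
       amplitude D y * ket (restrict y (outputs D)) z)"

text \<open>The linear extension of \<open>interp_ket\<close>.\<close>

definition interp :: "'v mbqc_diagram \<Rightarrow> 'v state \<Rightarrow> 'v state" where
  "interp D \<psi> = (\<lambda>z. \<Sum>x \<in> bitstrings (inputs D). \<psi> x * interp_ket D x z)"

lemma interp_on_ket:
  assumes "wf_diagram D" "x \<in> bitstrings (inputs D)"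
  shows "interp D (ket x) = interp_ket D x"
proof
  fix z
  have "finite (inputs D)"
    using assms(1) finite_subset unfolding wf_diagram_def wf_open_graph_def by blast
  then have "finite (bitstrings (inputs D))"
    unfolding bitstrings_def by (rule finite_PiE) simp
  moreover have "interp D (ket x) z
      = (\<Sum>x' \<in> bitstrings (inputs D). if x' = x then interp_ket D x' z else 0)"
    unfolding interp_def ket_def by (rule sum.cong) auto
  ultimately show "interp D (ket x) z = interp_ket D x z"
    using assms(2) by simp
qed

definition same_operation :: "'v mbqc_diagram \<Rightarrow> 'v mbqc_diagram \<Rightarrow> bool" where
  "same_operation D D' \<longleftrightarrow>
     inputs D = inputs D' \<and> outputs D = outputs D' \<and>
     (\<exists>c. c \<noteq> 0 \<and> (\<forall>\<psi> z. interp D \<psi> z = c * interp D' \<psi> z))"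


section \<open>Flow of labelled open graphs\<close>

text \<open>Only the values of \<open>lab\<close> on non-outputs are meaningful.\<close>

record 'v labelled_open_graph = "'v open_graph" +
  lab :: "'v \<Rightarrow> label"

definition flow_rel :: "'v labelled_open_graph \<Rightarrow> ('v \<Rightarrow> 'v set) \<Rightarrow> 'v rel" where
  "flow_rel G c = {(u, v). u \<in> non_outputs G \<and> v \<in> verts G \<and> u \<noteq> v \<and>
     (v \<in> c u \<and> (v \<in> outputs G \<or> lab G v \<notin> {MX, MY}) \<or>
      v \<in> odd_nbhd G (c u) \<and> (v \<in> outputs G \<or> lab G v \<notin> {MY, MZ}) \<or>
      v \<in> odd_nbhd_closed G (c u) \<and> v \<notin> outputs G \<and> lab G v = MY)}"

definition generates_strict_order :: "'v rel \<Rightarrow> bool" where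
  "generates_strict_order R \<longleftrightarrow> irrefl (R\<^sup>+) \<and> trans (R\<^sup>+)"

fun flow_condition :: "'v labelled_open_graph \<Rightarrow> 'v \<Rightarrow> 'v set \<Rightarrow> label \<Rightarrow> bool" where
  "flow_condition G u S MXY \<longleftrightarrow> u \<notin> S \<and> u \<in> odd_nbhd G S"
| "flow_condition G u S MXZ \<longleftrightarrow> u \<in> S \<and> u \<in> odd_nbhd G S"
| "flow_condition G u S MYZ \<longleftrightarrow> u \<in> S \<and> u \<notin> odd_nbhd G S"
| "flow_condition G u S MX \<longleftrightarrow> u \<in> odd_nbhd G S"
| "flow_condition G u S MZ \<longleftrightarrow> u \<in> S"
| "flow_condition G u S MY \<longleftrightarrow> u \<in> odd_nbhd_closed G S"

definition pauli_flow :: "'v labelled_open_graph \<Rightarrow> ('v \<Rightarrow> 'v set) \<Rightarrow> bool" where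
  "pauli_flow G p \<longleftrightarrow>
     p \<in> non_outputs G \<rightarrow> Pow (non_inputs G) \<and>
     generates_strict_order (flow_rel G p) \<and>
     (\<forall>u \<in> non_outputs G. flow_condition G u (p u) (lab G u))"

definition gflow :: "'v labelled_open_graph \<Rightarrow> ('v \<Rightarrow> 'v set) \<Rightarrow> bool" where
  "gflow G p \<longleftrightarrow> lab G ` non_outputs G \<subseteq> planar \<and> pauli_flow G p"

definition extended_causal_flow :: "'v labelled_open_graph \<Rightarrow> ('v \<Rightarrow> 'v) \<Rightarrow> bool" where
  "extended_causal_flow G f \<longleftrightarrow>
     lab G ` non_outputs G \<subseteq> {MXY, MYZ} \<and>
     f \<in> non_outputs G \<rightarrow> non_inputs G \<and>
     generates_strict_order (flow_rel G (\<lambda>v. {f v})) \<and>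
     (\<forall>v \<in> non_outputs G.
        (lab G v = MXY \<longrightarrow> f v \<in> neighbours G v) \<and>
        (lab G v = MYZ \<longrightarrow> f v = v))"


section \<open>Flow of diagrams\<close>

definition corresponds :: "'v labelled_open_graph \<Rightarrow> 'v mbqc_diagram \<Rightarrow> bool" where
  "corresponds G D \<longleftrightarrow>
     verts G = verts D \<and> edges G = edges D \<and> inputs G = inputs D \<and> outputs G = outputs D \<and>
     (\<forall>v \<in> non_outputs D. has_type (eff D v) (lab G v))"

definition num_pauli :: "'v labelled_open_graph \<Rightarrow> nat" where
  "num_pauli G = card {v \<in> non_outputs G. lab G v \<in> pauli}"

text \<open>For a well-formed diagram such a labelled open graph exists, and its labels are uniquely
  determined on the non-outputs.\<close>

definition max_pauli_corresponds :: "'v labelled_open_graph \<Rightarrow> 'v mbqc_diagram \<Rightarrow> bool" where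
  "max_pauli_corresponds G D \<longleftrightarrow>
     corresponds G D \<and> (\<forall>G'. corresponds G' D \<longrightarrow> num_pauli G' \<le> num_pauli G)"

definition has_pauli_flow :: "'v mbqc_diagram \<Rightarrow> bool" where
  "has_pauli_flow D \<longleftrightarrow> (\<exists>G p. max_pauli_corresponds G D \<and> pauli_flow G p)"

definition has_gflow :: "'v mbqc_diagram \<Rightarrow> bool" where
  "has_gflow D \<longleftrightarrow> (\<exists>G p. corresponds G D \<and> gflow G p)"

definition has_extended_causal_flow :: "'v mbqc_diagram \<Rightarrow> bool" where
  "has_extended_causal_flow D \<longleftrightarrow> (\<exists>G f. corresponds G D \<and> extended_causal_flow G f)"


section \<open>Spider nests\<close>

definition phase_gadget :: "'v mbqc_diagram \<Rightarrow> 'v \<Rightarrow> real \<Rightarrow> bool" where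
  "phase_gadget D g \<alpha> \<longleftrightarrow>
     g \<in> non_outputs D \<and> g \<in> non_inputs D \<and> proportional (eff D g) (effect_YZ \<alpha>)"

text \<open>A non-zero bit string of length \<open>n\<close> is represented by the non-empty set of positions at
  which it is 1, so that its Hamming weight is the cardinality of that set.\<close>

definition nest_index :: "nat \<Rightarrow> nat set set" where
  "nest_index n = Pow {1..n} - {{}}"

definition full_spider_nest ::
    "'v mbqc_diagram \<Rightarrow> nat \<Rightarrow> real \<Rightarrow> (nat \<Rightarrow> 'v) \<Rightarrow> (nat set \<Rightarrow> 'v) \<Rightarrow> bool" where
  "full_spider_nest D n \<phi> q g \<longleftrightarrow>
     n \<ge> 1 \<and>
     inj_on q {1..n} \<and> q ` {1..n} \<subseteq> verts D \<and>
     inj_on g (nest_index n) \<and> g ` nest_index n \<inter> q ` {1..n} = {} \<and>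
     (\<forall>s \<in> nest_index n.
        neighbours D (g s) = q ` s \<and>
        phase_gadget D (g s) ((- 1) ^ (card s - 1) * (\<phi> / 2 ^ (n - 1))))"

definition delete_vertices :: "'v mbqc_diagram \<Rightarrow> 'v set \<Rightarrow> 'v mbqc_diagram" where
  "delete_vertices D S =
     \<lparr>verts = verts D - S, edges = {e \<in> edges D. e \<inter> S = {}},
      inputs = inputs D - S, outputs = outputs D - S, eff = eff D\<rparr>"

definition remove_nest :: "'v mbqc_diagram \<Rightarrow> nat \<Rightarrow> (nat set \<Rightarrow> 'v) \<Rightarrow> 'v mbqc_diagram" where
  "remove_nest D n g = delete_vertices D (g ` nest_index n)"

lemma wf_diagram_delete_vertices:
  assumes "wf_diagram D"
  shows "wf_diagram (delete_vertices D S)"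
proof -
  have "{e \<in> edges D. e \<inter> S = {}}
      \<subseteq> {{u, w} |u w. u \<in> verts D - S \<and> w \<in> verts D - S \<and> u \<noteq> w}"
  proof
    fix e
    assume e: "e \<in> {e \<in> edges D. e \<inter> S = {}}"
    then obtain u w where "e = {u, w}" "u \<in> verts D" "w \<in> verts D" "u \<noteq> w"
      using assms unfolding wf_diagram_def wf_open_graph_def by blast
    with e show "e \<in> {{u, w} |u w. u \<in> verts D - S \<and> w \<in> verts D - S \<and> u \<noteq> w}"
      by auto
  qed
  then show ?thesis
    using assms
    unfolding wf_diagram_def wf_open_graph_def delete_vertices_def non_outputs_def by auto
qed

end

theory Submission
  imports Defs
begin

text \<open>
  Summing over the bit of the gadget \<open>g s\<close> multiplies the amplitude by \<open>exp (\<i> * \<alpha>\<^sub>s)\<close>, up to a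
  constant, if the parity of the qubits in \<open>s\<close> is odd, and by 1 otherwise; by inclusion-exclusion
  all these phases add up to the phase of the nest if all qubits are 1, and to 0 otherwise.

  For the flows, the angles of the gadgets restrict their labels to \<open>Z, XZ, YZ\<close> if \<open>n \<le> 2\<close> and to
  \<open>Y, XY, YZ\<close> if \<open>n \<ge> 3\<close>, so a Pauli flow survives relabelling all gadgets with \<open>Z\<close> or \<open>Y\<close>
  respectively. Gaussian elimination then makes every other correction set act on each gadget
  trivially or by the Pauli of its label. In the case of \<open>Z\<close> the gadgets have left all these sets.
  In the case of \<open>Y\<close> a gadget \<open>g s\<close> lies in a correction set \<open>A\<close> iff it lies in the odd neighbourhood
  of \<open>A\<close>, that is, iff \<open>A\<close> contains an odd number of qubits in \<open>s\<close>. For each qubit, the number of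
  adjacent gadgets in \<open>A\<close> is then even, so that deleting the gadgets does not change the odd
  neighbourhoods of the remaining vertices.
\<close>

section \<open>Pauli flow and Gaussian elimination\<close>

text \<open>The product of the stabilizers of the vertices in \<open>S\<close> acts at
  \<open>v\<close> by a power of X (membership in \<open>S\<close>) times a power of Z (membership
  in the odd neighbourhood). For a Pauli label this predicate says that the action anticommutes with
  that Pauli; for planar labels and outputs, that it is not trivial.\<close>

definition affects :: "'v labelled_open_graph \<Rightarrow> 'v set \<Rightarrow> 'v \<Rightarrow> bool" where
  "affects G S v \<longleftrightarrow>
     v \<in> S \<and> (v \<in> outputs G \<or> lab G v \<notin> {MX, MY}) \<or>
     v \<in> odd_nbhd G S \<and> (v \<in> outputs G \<or> lab G v \<notin> {MY, MZ}) \<or>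
     v \<in> odd_nbhd_closed G S \<and> v \<notin> outputs G \<and> lab G v = MY"

lemma flow_rel_iff:
  "(u, v) \<in> flow_rel G c \<longleftrightarrow>
     u \<in> non_outputs G \<and> v \<in> verts G \<and> u \<noteq> v \<and> affects G (c u) v"
  by (simp add: flow_rel_def affects_def)

lemma odd_card_Int_sym_diff:
  assumes "finite N"
  shows "odd (card (N \<inter> sym_diff A B)) \<longleftrightarrow> odd (card (N \<inter> A)) \<noteq> odd (card (N \<inter> B))"
proof -
  have "card (N \<inter> A) = card (N \<inter> A - B) + card (N \<inter> A \<inter> B)"
    using assms by (metis add.commute card_Int_Diff finite_Int)
  moreover have "card (N \<inter> B) = card (N \<inter> B - A) + card (N \<inter> A \<inter> B)"
    using assms by (metis (no_types, lifting) add.commute card_Int_Diff finite_Int inf_assoc inf_commute)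
  moreover have "card (N \<inter> sym_diff A B) = card (N \<inter> A - B) + card (N \<inter> B - A)"
    using assms by (subst card_Un_disjoint[symmetric]) (auto intro: arg_cong[where f = card])
  ultimately show ?thesis by simp blast
qed

lemma finite_neighbours: "wf_open_graph G \<Longrightarrow> finite (neighbours G v)"
  by (auto simp: wf_open_graph_def neighbours_def)

lemma neighbours_sym:
  "u \<in> verts G \<Longrightarrow> v \<in> neighbours G u \<Longrightarrow> u \<in> neighbours G v"
  by (auto simp: neighbours_def insert_commute)

lemma odd_nbhd_sym_diff:
  assumes "wf_open_graph G"
  shows "odd_nbhd G (sym_diff A B) = sym_diff (odd_nbhd G A) (odd_nbhd G B)"
  unfolding odd_nbhd_def using odd_card_Int_sym_diff[OF finite_neighbours[OF assms]] by blast

lemma affects_sym_diff: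
  assumes "wf_open_graph G" "affects G (sym_diff A B) v"
  shows "affects G A v \<or> affects G B v"
  using assms(2) unfolding affects_def odd_nbhd_closed_def odd_nbhd_sym_diff[OF assms(1)] by blast

lemma flow_condition_sym_diff:
  assumes "wf_open_graph G" "u \<in> non_outputs G" "\<not> affects G B u"
    and "flow_condition G u A (lab G u)"
  shows "flow_condition G u (sym_diff A B) (lab G u)"
  using assms(2-) by (cases "lab G u")
    (auto simp: affects_def odd_nbhd_closed_def odd_nbhd_sym_diff[OF assms(1)] non_outputs_def)

lemma affects_pauli:
  assumes "u \<in> non_outputs G" "lab G u \<in> pauli" "flow_condition G u S (lab G u)"
  shows "affects G S u"
  using assms by (auto simp: affects_def pauli_def non_outputs_def)

text \<open>For a Pauli label, being affected is a single linear condition over the field with two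
  elements, so two contributions cancel. This is what allows a Pauli vertex to serve as a
  pivot.\<close>

lemma affects_pauli_sym_diff:
  assumes "wf_open_graph G" "u \<in> non_outputs G" "lab G u \<in> pauli" "affects G A u" "affects G B u"
  shows "\<not> affects G (sym_diff A B) u"
  using assms(2-) unfolding affects_def odd_nbhd_closed_def odd_nbhd_sym_diff[OF assms(1)]
  by (auto simp: pauli_def non_outputs_def)

text \<open>The transitive closure is allowed on the right because elimination creates arrows that
  are composites of two old ones.\<close>

lemma generates_strict_order_mono:
  assumes "generates_strict_order R" "R' \<subseteq> R\<^sup>+"
  shows "generates_strict_order R'"
proof -
  have "R'\<^sup>+ \<subseteq> R\<^sup>+" using assms(2) trancl_mono_subset[of R' "R\<^sup>+"] by simp
  with assms(1) show ?thesis by (auto simp: generates_strict_order_def irrefl_def)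
qed

text \<open>Gaussian elimination: adding the correction set of a Pauli vertex \<open>u\<close> to all correction sets
  that affect \<open>u\<close> makes \<open>u\<close> maximal in the flow order.\<close>

lemma pauli_flow_eliminate_vertex:
  assumes wf: "wf_open_graph G" and p: "pauli_flow G p"
    and u: "u \<in> non_outputs G" "lab G u \<in> pauli"
  defines "p' \<equiv> \<lambda>v. if (v, u) \<in> flow_rel G p then sym_diff (p v) (p u) else p v"
  shows "pauli_flow G p'"
    and "(v, u) \<notin> flow_rel G p'"
    and "(\<And>v. (v, w) \<notin> flow_rel G p) \<Longrightarrow> (v, w) \<notin> flow_rel G p'"
proof -
  let ?R = "flow_rel G p"
  have irr: "(x, x) \<notin> ?R\<^sup>+" for x
    using p by (auto simp: pauli_flow_def generates_strict_order_def irrefl_def)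
  have p'_u: "p' u = p u" by (simp add: p'_def flow_rel_iff)
  \<comment> \<open>A new arrow that is not an old one comes from the added set \<open>p u\<close>,
    hence follows the old path from \<open>v\<close> through \<open>u\<close> to
    \<open>w\<close>.\<close>
  have split: "(v, w) \<in> ?R \<or> (v, u) \<in> ?R \<and> (u, w) \<in> ?R" if "(v, w) \<in> flow_rel G p'" for v w
  proof (cases "(v, u) \<in> ?R")
    case True
    then have "affects G (p v) w \<or> affects G (p u) w"
      using that affects_sym_diff[OF wf] by (auto simp: flow_rel_iff p'_def)
    moreover have "w \<noteq> u"
    proof
      assume "w = u"
      with True that have "\<not> affects G (p u) u"
        using affects_pauli_sym_diff[OF wf u] by (auto simp: flow_rel_iff p'_def)
      then show False using affects_pauli[OF u] p u by (auto simp: pauli_flow_def)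
    qed
    ultimately show ?thesis using True that u by (auto simp: flow_rel_iff)
  next
    case False
    then show ?thesis using that by (auto simp: flow_rel_iff p'_def)
  qed
  have "flow_condition G v (p' v) (lab G v)" if "v \<in> non_outputs G" for v
  proof (cases "(v, u) \<in> ?R")
    case True
    \<comment> \<open>As \<open>u\<close> lies above \<open>v\<close>, the set \<open>p u\<close>
      cannot affect \<open>v\<close>, and adding it preserves the condition at
      \<open>v\<close>.\<close>
    then have "(u, v) \<notin> ?R" using irr by (meson trancl.intros)
    then have "\<not> affects G (p u) v" using True u by (auto simp: flow_rel_iff non_outputs_def)
    then show ?thesis using flow_condition_sym_diff[OF wf that] True p that
      by (auto simp: pauli_flow_def p'_def)
  qed (use p that in \<open>auto simp: pauli_flow_def p'_def\<close>)
  moreover have "flow_rel G p' \<subseteq> ?R\<^sup>+"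
    using split by (meson subrelI trancl.intros)
  then have "generates_strict_order (flow_rel G p')"
    using p generates_strict_order_mono by (auto simp: pauli_flow_def)
  moreover have "p' \<in> non_outputs G \<rightarrow> Pow (non_inputs G)"
    using p u by (auto simp: pauli_flow_def p'_def Pi_iff split: if_splits)
  ultimately show "pauli_flow G p'" by (simp add: pauli_flow_def)
  show "(v, u) \<notin> flow_rel G p'"
  proof
    assume *: "(v, u) \<in> flow_rel G p'"
    then have vu: "(v, u) \<in> ?R" using split by blast
    then have "affects G (p v) u" "affects G (p u) u"
      using affects_pauli[OF u] p u by (auto simp: flow_rel_iff pauli_flow_def)
    with * vu show False
      using affects_pauli_sym_diff[OF wf u] by (auto simp: flow_rel_iff p'_def)
  qed
  show "(\<And>v. (v, w) \<notin> ?R) \<Longrightarrow> (v, w) \<notin> flow_rel G p'"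
    using split by blast
qed

text \<open>By the last claim of the vertex elimination, earlier pivots stay without incoming
  arrows, so the vertices of \<open>S\<close> can be treated one by one.\<close>

lemma pauli_flow_eliminate:
  assumes wf: "wf_open_graph G" and p: "pauli_flow G p"
    and "finite S" "S \<subseteq> non_outputs G" "lab G ` S \<subseteq> pauli"
  shows "\<exists>p'. pauli_flow G p' \<and> (\<forall>u \<in> S. \<forall>v. (v, u) \<notin> flow_rel G p')"
  using assms(3-)
proof (induction S)
  case empty
  then show ?case using p by blast
next
  case (insert u S)
  then obtain p' where "pauli_flow G p'" "\<forall>u \<in> S. \<forall>v. (v, u) \<notin> flow_rel G p'" by auto
  then show ?case
    using pauli_flow_eliminate_vertex[OF wf \<open>pauli_flow G p'\<close>, of u] insert.prems
    by (intro exI[of _ "\<lambda>v. if (v, u) \<in> flow_rel G p' then sym_diff (p' v) (p' u) else p' v"]) auto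
qed

section \<open>Replacing planar labels by Pauli labels\<close>

definition relabel :: "'v set \<Rightarrow> label \<Rightarrow> 'v labelled_open_graph \<Rightarrow> 'v labelled_open_graph" where
  "relabel S l G = G\<lparr>lab := \<lambda>v. if v \<in> S then l else lab G v\<rparr>"

lemma relabel_simps [simp]:
  "verts (relabel S l G) = verts G" "edges (relabel S l G) = edges G"
  "inputs (relabel S l G) = inputs G" "outputs (relabel S l G) = outputs G"
  "lab (relabel S l G) = (\<lambda>v. if v \<in> S then l else lab G v)"
  "non_outputs (relabel S l G) = non_outputs G" "non_inputs (relabel S l G) = non_inputs G"
  "neighbours (relabel S l G) = neighbours G" "odd_nbhd (relabel S l G) = odd_nbhd G"
  "odd_nbhd_closed (relabel S l G) = odd_nbhd_closed G"
  "wf_open_graph (relabel S l G) = wf_open_graph G"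
  by (auto simp: relabel_def non_outputs_def non_inputs_def neighbours_def odd_nbhd_def fun_eq_iff
      odd_nbhd_closed_def wf_open_graph_def)

lemma flow_condition_relabel [simp]:
  "flow_condition (relabel S l G) = flow_condition G"
proof (intro ext)
  show "flow_condition (relabel S l G) u T k = flow_condition G u T k" for u T k
    by (cases k) auto
qed

text \<open>Apart from staying the same, a planar label may become a Pauli label lying in its plane.
  The targets are \<open>MY\<close> and \<open>MZ\<close> because these are the labels that the
  gadgets receive.\<close>

inductive specialises :: "label \<Rightarrow> label \<Rightarrow> bool" where
  "specialises l l"
| "specialises MXY MY" | "specialises MYZ MY" | "specialises MYZ MZ" | "specialises MXZ MZ"

text \<open>The Pauli condition follows from the planar one, and every set that affects a vertex
  under the Pauli label affects it under the planar one, so no arrow is created.\<close>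

lemma pauli_flow_relabel:
  assumes p: "pauli_flow G p" and S: "\<And>u. u \<in> S \<Longrightarrow> specialises (lab G u) l"
  shows "pauli_flow (relabel S l G) p"
proof -
  have "affects G T v" if "affects (relabel S l G) T v" for T v
  proof (cases "v \<in> S")
    case True
    show ?thesis using S[OF True] that True
      by (cases rule: specialises.cases) (auto simp: affects_def odd_nbhd_closed_def)
  qed (use that in \<open>auto simp: affects_def\<close>)
  then have "flow_rel (relabel S l G) p \<subseteq> (flow_rel G p)\<^sup>+"
    by (auto simp: flow_rel_iff)
  then have "generates_strict_order (flow_rel (relabel S l G) p)"
    using p by (auto simp: pauli_flow_def intro: generates_strict_order_mono)
  moreover have "flow_condition G u (p u) l" if "u \<in> S" "u \<in> non_outputs G" for u
  proof -
    have "flow_condition G u (p u) (lab G u)" using p that by (auto simp: pauli_flow_def)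
    with S[OF that(1)] show ?thesis
      by (auto elim!: specialises.cases simp: odd_nbhd_closed_def)
  qed
  ultimately show ?thesis using p by (auto simp: pauli_flow_def)
qed

section \<open>Deleting vertices from a graph with flow\<close>

definition remove_vertices :: "'v labelled_open_graph \<Rightarrow> 'v set \<Rightarrow> 'v labelled_open_graph" where
  "remove_vertices G S =
     \<lparr>verts = verts G - S, edges = {e \<in> edges G. e \<inter> S = {}},
      inputs = inputs G - S, outputs = outputs G - S, lab = lab G\<rparr>"

lemma remove_vertices_simps [simp]:
  "verts (remove_vertices G S) = verts G - S"
  "edges (remove_vertices G S) = {e \<in> edges G. e \<inter> S = {}}"
  "inputs (remove_vertices G S) = inputs G - S" "outputs (remove_vertices G S) = outputs G - S"
  "lab (remove_vertices G S) = lab G"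
  "non_outputs (remove_vertices G S) = non_outputs G - S"
  "non_inputs (remove_vertices G S) = non_inputs G - S"
  by (auto simp: remove_vertices_def non_outputs_def non_inputs_def)

lemma neighbours_remove_vertices:
  "w \<notin> S \<Longrightarrow> neighbours (remove_vertices G S) w = neighbours G w - S"
  by (auto simp: neighbours_def)

lemma odd_nbhd_remove_vertices:
  assumes wf: "wf_open_graph G" and even: "\<And>w. w \<in> verts G - S \<Longrightarrow> even (card (neighbours G w \<inter> S \<inter> A))"
  shows "odd_nbhd (remove_vertices G S) (A - S) = odd_nbhd G A - S"
proof -
  have "odd (card (neighbours (remove_vertices G S) w \<inter> (A - S))) \<longleftrightarrow> odd (card (neighbours G w \<inter> A))"
    if "w \<in> verts G - S" for w
  proof -
    have "card (neighbours G w \<inter> A)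
        = card (neighbours G w \<inter> A \<inter> S) + card (neighbours G w \<inter> A - S)"
      using finite_neighbours[OF wf] by (simp add: card_Int_Diff)
    moreover have "neighbours (remove_vertices G S) w \<inter> (A - S) = neighbours G w \<inter> A - S"
      using that neighbours_remove_vertices[of w S G] by auto
    moreover have "neighbours G w \<inter> A \<inter> S = neighbours G w \<inter> S \<inter> A" by blast
    ultimately show ?thesis using even[OF that] by simp
  qed
  then show ?thesis by (auto simp: odd_nbhd_def)
qed

text \<open>With \<open>c'\<close> kept separate from \<open>c\<close>, this also covers extended
  causal flow, where the correction sets are singletons before and after the deletion.\<close>

lemma flow_rel_remove_vertices:
  assumes "\<And>v. v \<in> non_outputs G - S \<Longrightarrow>
    c' v = c v - S \<and> odd_nbhd (remove_vertices G S) (c' v) = odd_nbhd G (c v) - S"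
  shows "flow_rel (remove_vertices G S) c' \<subseteq> flow_rel G c"
  using assms by (auto simp: flow_rel_def odd_nbhd_closed_def)

lemma pauli_flow_remove_vertices:
  assumes p: "pauli_flow G p"
    and odd: "\<And>v. v \<in> non_outputs G - S \<Longrightarrow>
      odd_nbhd (remove_vertices G S) (p v - S) = odd_nbhd G (p v) - S"
  shows "pauli_flow (remove_vertices G S) (\<lambda>v. p v - S)"
proof -
  have "flow_rel (remove_vertices G S) (\<lambda>v. p v - S) \<subseteq> (flow_rel G p)\<^sup>+"
    using flow_rel_remove_vertices[of G S "\<lambda>v. p v - S" p] odd by auto
  then have "generates_strict_order (flow_rel (remove_vertices G S) (\<lambda>v. p v - S))"
    using p by (auto simp: pauli_flow_def intro: generates_strict_order_mono)
  moreover have "flow_condition (remove_vertices G S) v (p v - S) (lab G v)"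
    if v: "v \<in> non_outputs G - S" for v
  proof -
    have "flow_condition G v (p v) (lab G v)" using p v by (auto simp: pauli_flow_def)
    then show ?thesis
      by (cases "lab G v") (use odd[OF v] v in \<open>auto simp: odd_nbhd_closed_def\<close>)
  qed
  ultimately show ?thesis using p by (auto simp: pauli_flow_def)
qed

section \<open>Labels of gadgets and removal of the nest\<close>

text \<open>Up to a positive factor this depends only on the effect modulo scalars. It is 0 for \<open>Z\<close> effects,
  real for \<open>XZ\<close> effects, imaginary for \<open>YZ\<close> effects and non-zero for \<open>XY\<close> effects.\<close>

definition interference :: "bra \<Rightarrow> complex" where
  "interference e = e False * cnj (e True)"

lemma interference_proportional:
  assumes "proportional e e'"
  obtains r :: real where "r > 0" "interference e = r * interference e'"
proof -
  obtain c where c: "c \<noteq> 0" "\<And>b. e b = c * e' b" using assms by (auto simp: proportional_def)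
  have "interference e = (c * cnj c) * interference e'"
    by (simp add: interference_def c(2))
  also have "c * cnj c = (cmod c)\<^sup>2" by (simp only: complex_norm_square)
  finally have "interference e = complex_of_real ((cmod c)\<^sup>2) * interference e'" by simp
  with c(1) show ?thesis using that[of "(cmod c)\<^sup>2"] by simp
qed

lemma interference_YZ: "interference (effect_YZ \<alpha>) = \<i> * sin \<alpha>"
  by (simp add: interference_def effect_YZ_def bra_plus_def bra_minus_def bra_zero_def bra_one_def
      complex_eq_iff exp_eq_polar cis.sel field_simps power2_eq_square[symmetric] sin_squared_eq)

lemma interference_XZ: "interference (effect_XZ \<alpha>) = sin \<alpha>"
proof -
  have "interference (effect_XZ \<alpha>) = interference (effect_YZ \<alpha>) * cnj \<i>"
    by (simp add: interference_def effect_XZ_def effect_YZ_def)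
  then show ?thesis by (simp add: interference_YZ complex_eq_iff)
qed

lemma interference_XY: "interference (effect_XY \<alpha>) = cis (- \<alpha>)"
  by (simp add: interference_def effect_XY_def bra_zero_def bra_one_def cis_cnj flip: cis_conv_exp)

text \<open>The interference of a gadget is i sin \<alpha> up to a positive factor. If it is 0, all
  labels measured by XY effects are excluded. If it is imaginary and non-zero, so are
  \<open>MZ\<close>, where it would be 0, and \<open>MX\<close> and \<open>MXZ\<close>, where it
  would be real.\<close>

lemma label_of_phase_gadget:
  assumes "proportional e (effect_YZ \<alpha>)" "has_type e l"
  shows "sin \<alpha> = 0 \<Longrightarrow> specialises l MZ" and "sin \<alpha> \<noteq> 0 \<Longrightarrow> specialises l MY"
proof -
  obtain r :: real where r: "r > 0" "interference e = r * (\<i> * sin \<alpha>)"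
    using interference_proportional[OF assms(1)] by (metis interference_YZ)
  obtain \<beta> where "\<beta> \<in> allowed_angles l" "proportional e (measurement_effect l \<beta>)"
    using assms(2) by (auto simp: has_type_def)
  moreover then obtain r' :: real
    where "r' > 0" "interference e = r' * interference (measurement_effect l \<beta>)"
    using interference_proportional by blast
  ultimately have *: "\<beta> \<in> allowed_angles l" "r' > 0"
    "r * (\<i> * sin \<alpha>) = r' * interference (measurement_effect l \<beta>)"
    using r(2) by simp_all
  show "sin \<alpha> = 0 \<Longrightarrow> specialises l MZ"
    using * by (cases l) (auto simp: interference_XY intro: specialises.intros)
  show "sin \<alpha> \<noteq> 0 \<Longrightarrow> specialises l MY"
    using * r(1) by (cases l)
      (auto simp: interference_XY interference_YZ interference_XZ complex_eq_iff
        intro: specialises.intros)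
qed

text \<open>Up to sign the phase is 2 \<pi> for \<open>n = 1\<close>, \<pi> for
  \<open>n = 2\<close>, and strictly between 0 and \<pi> from \<open>n = 3\<close> on.\<close>

lemma sin_nest_phase_eq_0_iff:
  assumes "n \<ge> 1"
  shows "sin ((- 1) ^ m * (2 * pi / 2 ^ (n - 1))) = 0 \<longleftrightarrow> n \<le> 2"
proof -
  have "sin ((- 1) ^ m * x) = (- 1) ^ m * sin x" for x :: real
    by (cases "even m") auto
  then have "sin ((- 1) ^ m * (2 * pi / 2 ^ (n - 1))) = 0 \<longleftrightarrow> sin (2 * pi / 2 ^ (n - 1)) = 0"
    by (simp only: mult_eq_0_iff power_eq_0_iff) simp
  also have "\<dots> \<longleftrightarrow> n \<le> 2"
  proof (cases "n \<le> 2")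
    case True
    with assms have "n = 1 \<or> n = 2" by auto
    then show ?thesis by auto
  next
    case False
    have "(2::real) ^ 2 \<le> 2 ^ (n - 1)" using False by (intro power_increasing) auto
    then have "0 < 2 * pi / 2 ^ (n - 1)" "2 * pi / 2 ^ (n - 1) < pi" by (auto simp: field_simps)
    then have "sin (2 * pi / 2 ^ (n - 1)) > 0" by (rule sin_gt_zero)
    with False show ?thesis by simp
  qed
  finally show ?thesis .
qed

text \<open>In the application \<open>P\<close> consists of the qubits in a correction set, and
  \<open>k\<close> is the qubit whose gadgets are counted. Two elements of \<open>A\<close> other
  than \<open>k\<close> yield a non-empty \<open>T\<close> that meets \<open>P\<close> evenly: one
  of them if it is outside \<open>P\<close>, otherwise both together.\<close>

lemma even_card_odd_intersection:
  assumes A: "finite A" "card A \<ge> 3"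
  shows "even (card {s \<in> Pow A. k \<in> s \<and> odd (card (s \<inter> P))})" (is "even (card ?F)")
proof -
  have "card (A - {k}) \<ge> 2" using A by (auto simp: card_Diff_singleton_if)
  then obtain B where "B \<subseteq> A - {k}" "card B = 2" by (meson obtain_subset_with_card_n)
  then obtain a b where ab: "a \<noteq> b" "a \<in> A" "b \<in> A" "a \<noteq> k" "b \<noteq> k"
    by (auto simp: card_2_iff)
  have "\<exists>T. T \<subseteq> A - {k} \<and> T \<noteq> {} \<and> even (card (T \<inter> P))"
  proof -
    consider "a \<notin> P" | "b \<notin> P" | "a \<in> P" "b \<in> P" by blast
    then show ?thesis
    proof cases
      case 1 then show ?thesis using ab by (intro exI[of _ "{a}"]) auto
    next
      case 2 then show ?thesis using ab by (intro exI[of _ "{b}"]) auto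
    next
      case 3 then show ?thesis using ab by (intro exI[of _ "{a, b}"]) auto
    qed
  qed
  then obtain T t where T: "T \<subseteq> A - {k}" "t \<in> T" "even (card (T \<inter> P))" by blast
  \<comment> \<open>\<open>s \<mapsto> sym_diff s T\<close> is an involution of \<open>?F\<close> without fixed points.\<close>
  have inv: "sym_diff s T \<in> ?F" if "s \<in> ?F" for s
  proof -
    have "finite P'" if "P' \<subseteq> A" for P' using A(1) that finite_subset by blast
    then have "odd (card (P \<inter> A \<inter> sym_diff s T)) \<longleftrightarrow> odd (card (P \<inter> A \<inter> s)) \<noteq> odd (card (P \<inter> A \<inter> T))"
      by (intro odd_card_Int_sym_diff) simp
    moreover have "P \<inter> A \<inter> sym_diff s T = sym_diff s T \<inter> P" "P \<inter> A \<inter> s = s \<inter> P" "P \<inter> A \<inter> T = T \<inter> P"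
      using that T(1) by auto
    ultimately show ?thesis using that T by auto
  qed
  have "card {s \<in> ?F. t \<in> s} = card {s \<in> ?F. t \<notin> s}"
  proof (rule bij_betw_same_card[of "\<lambda>s. sym_diff s T"], rule bij_betwI[where g = "\<lambda>s. sym_diff s T"])
    show "(\<lambda>s. sym_diff s T) \<in> {s \<in> ?F. t \<in> s} \<rightarrow> {s \<in> ?F. t \<notin> s}"
      using inv T(2) by blast
    show "(\<lambda>s. sym_diff s T) \<in> {s \<in> ?F. t \<notin> s} \<rightarrow> {s \<in> ?F. t \<in> s}"
      using inv T(2) by blast
  qed auto
  moreover have "card ?F = card ({s \<in> ?F. t \<in> s} \<union> {s \<in> ?F. t \<notin> s})"
    by (rule arg_cong[where f = card]) blast
  then have "card ?F = card {s \<in> ?F. t \<in> s} + card {s \<in> ?F. t \<notin> s}"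
    using A(1) by (subst card_Un_disjoint[symmetric]) auto
  ultimately show ?thesis by simp
qed

section \<open>Labelled open graphs of the reduced diagram\<close>

lemma corresponds_simps:
  assumes "corresponds G D"
  shows "verts G = verts D" "edges G = edges D" "inputs G = inputs D" "outputs G = outputs D"
    "non_outputs G = non_outputs D" "non_inputs G = non_inputs D" "neighbours G = neighbours D"
    "wf_open_graph G = wf_open_graph D"
  using assms by (auto simp: corresponds_def non_outputs_def non_inputs_def neighbours_def fun_eq_iff
      wf_open_graph_def)

lemma corresponds_remove_vertices:
  "corresponds G D \<Longrightarrow> corresponds (remove_vertices G S) (delete_vertices D S)"
  by (auto simp: corresponds_def delete_vertices_def non_outputs_def)

text \<open>Labels are chosen independently at each vertex: a labelling \<open>H\<close> of the
  remaining vertices with more Pauli labels, glued to the labels of \<open>G\<close> on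
  \<open>S\<close>, would beat \<open>G\<close> on \<open>D\<close>.\<close>

lemma max_pauli_corresponds_remove_vertices:
  assumes wf: "wf_open_graph D" and G: "max_pauli_corresponds G D"
  shows "max_pauli_corresponds (remove_vertices G S) (delete_vertices D S)"
proof -
  have GD: "corresponds G D" using G by (simp add: max_pauli_corresponds_def)
  have fin: "finite (non_outputs D)" using wf by (simp add: wf_open_graph_def non_outputs_def)
  have "num_pauli H \<le> num_pauli (remove_vertices G S)" if H: "corresponds H (delete_vertices D S)" for H
  proof -
    define G' where "G' = G\<lparr>lab := \<lambda>v. if v \<in> S then lab G v else lab H v\<rparr>"
    have no_G': "non_outputs G' = non_outputs D" using GD
      by (auto simp: corresponds_def G'_def non_outputs_def)
    have *: "num_pauli K = card {v \<in> non_outputs D \<inter> S. lab K v \<in> pauli}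
        + card {v \<in> non_outputs D - S. lab K v \<in> pauli}" if "non_outputs K = non_outputs D" for K
      unfolding num_pauli_def that using fin
      by (subst card_Un_disjoint[symmetric]) (auto intro: arg_cong[where f = card])
    have "corresponds G' D"
      using GD H by (auto simp: corresponds_def G'_def delete_vertices_def non_outputs_def)
    then have "num_pauli G' \<le> num_pauli G" using G by (simp add: max_pauli_corresponds_def)
    then have "card {v \<in> non_outputs D - S. lab G' v \<in> pauli} \<le> card {v \<in> non_outputs D - S. lab G v \<in> pauli}"
      using *[of G] *[OF no_G'] corresponds_simps(5)[OF GD] by (simp add: G'_def cong: conj_cong)
    moreover have "{v \<in> non_outputs D - S. lab G' v \<in> pauli} = {v \<in> non_outputs H. lab H v \<in> pauli}"
      using corresponds_simps(5)[OF H] by (auto simp: G'_def delete_vertices_def non_outputs_def)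
    ultimately show ?thesis using GD by (simp add: num_pauli_def corresponds_simps)
  qed
  then show ?thesis
    using corresponds_remove_vertices[OF GD] by (auto simp: max_pauli_corresponds_def)
qed

text \<open>Once the gadgets are deleted, their auxiliary labels can be forgotten, so the flow found
  belongs to the original labels.\<close>

lemma pauli_flow_relabel_outside:
  assumes "S \<inter> verts G = {}"
  shows "pauli_flow (relabel S l G) p = pauli_flow G p"
proof -
  have "v \<notin> S" if "v \<in> verts G" for v using assms that by blast
  then have "flow_rel (relabel S l G) p = flow_rel G p"
    by (auto simp: flow_rel_def)
  moreover have "v \<notin> S" if "v \<in> non_outputs G" for v
    using assms that by (auto simp: non_outputs_def)
  ultimately show ?thesis by (simp add: pauli_flow_def)
qed

lemma remove_vertices_relabel:
  "remove_vertices (relabel S l G) T = relabel S l (remove_vertices G T)"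
  by (simp add: remove_vertices_def relabel_def fun_eq_iff)

lemma full_spider_nestD:
  assumes "wf_diagram D" "full_spider_nest D n \<phi> q g"
  shows "n \<ge> 1" "inj_on q {1..n}" "inj_on g (nest_index n)" "g ` nest_index n \<inter> q ` {1..n} = {}"
    "g ` nest_index n \<subseteq> non_outputs D" "g ` nest_index n \<subseteq> non_inputs D" "finite (g ` nest_index n)"
    and "\<And>s. s \<in> nest_index n \<Longrightarrow> neighbours D (g s) = q ` s"
    and "\<And>s. s \<in> nest_index n \<Longrightarrow>
      proportional (eff D (g s)) (effect_YZ ((- 1) ^ (card s - 1) * (\<phi> / 2 ^ (n - 1))))"
  using assms(2) by (auto simp: full_spider_nest_def phase_gadget_def nest_index_def)

lemma nest_gadget_label:
  assumes wf: "wf_diagram D" and nest: "full_spider_nest D n (2 * pi) q g"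
    and "corresponds G D" "v \<in> g ` nest_index n"
  shows "specialises (lab G v) (if n \<le> 2 then MZ else MY)"
proof -
  obtain s where s: "v = g s" "s \<in> nest_index n" using assms(4) by blast
  note nestD = full_spider_nestD[OF wf nest]
  have "has_type (eff D v) (lab G v)"
    using assms(3,4) nestD(5) by (auto simp: corresponds_def)
  then show ?thesis
    using label_of_phase_gadget[OF nestD(9)[OF s(2)]] s(1) sin_nest_phase_eq_0_iff[OF nestD(1)]
    by simp
qed

lemma pauli_flow_remove_nest:
  assumes wf: "wf_diagram D" and nest: "full_spider_nest D n (2 * pi) q g"
    and GD: "corresponds G D" and p: "pauli_flow G p"
  shows "\<exists>p'. pauli_flow (remove_vertices G (g ` nest_index n)) p'"
proof -
  define S where "S = g ` nest_index n"
  define l where "l = (if n \<le> 2 then MZ else MY)"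
  define H where "H = relabel S l G"
  note nestD = full_spider_nestD[OF wf nest, folded S_def]
  have H [simp]: "non_outputs H = non_outputs D" "outputs H = outputs D" "verts H = verts D"
    "neighbours H = neighbours D" "wf_open_graph H"
    using wf by (simp_all add: H_def corresponds_simps[OF GD] wf_diagram_def)
  have "pauli_flow H p"
    unfolding H_def l_def
    by (rule pauli_flow_relabel[OF p]) (use nest_gadget_label[OF wf nest GD] in \<open>simp add: S_def\<close>)
  moreover have "lab H ` S \<subseteq> pauli" by (auto simp: H_def l_def pauli_def)
  ultimately obtain p' where p': "pauli_flow H p'" "\<And>u v. u \<in> S \<Longrightarrow> (v, u) \<notin> flow_rel H p'"
    using pauli_flow_eliminate[of H p S] nestD(5,7) H by metis
  have even: "even (card (neighbours H w \<inter> S \<inter> p' v))"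
    if v: "v \<in> non_outputs H - S" and w: "w \<in> verts H - S" for v w
  proof -
    have unaff: "\<not> affects H (p' v) u" if "u \<in> S" for u
      using p'(2)[OF that, of v] v that nestD(5) by (auto simp: flow_rel_iff non_outputs_def)
    have out: "u \<notin> outputs D \<and> u \<in> verts D" if "u \<in> S" for u
      using that nestD(5) by (auto simp: non_outputs_def)
    show ?thesis
    proof (cases "n \<le> 2")
      case True
      then have "u \<notin> p' v" if "u \<in> S" for u
        using unaff[OF that] out[OF that] that by (simp add: affects_def H_def l_def)
      then have "neighbours H w \<inter> S \<inter> p' v = {}" by blast
      then show ?thesis by simp
    next
      case False
      define P where "P = {i \<in> {1..n}. q i \<in> p' v}"
      have mem: "g s \<in> p' v \<longleftrightarrow> odd (card (s \<inter> P))" if s: "s \<in> nest_index n" for s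
      proof -
        have gs: "g s \<in> S" using s by (simp add: S_def)
        have "g s \<notin> odd_nbhd_closed H (p' v)"
          using unaff[OF gs] out[OF gs] gs False by (auto simp: affects_def H_def l_def corresponds_simps[OF GD])
        then have "g s \<in> p' v \<longleftrightarrow> g s \<in> odd_nbhd H (p' v)" by (auto simp: odd_nbhd_closed_def)
        also have "\<dots> \<longleftrightarrow> odd (card (q ` s \<inter> p' v))"
          using out[OF gs] nestD(8)[OF s] by (simp add: odd_nbhd_def)
        also have "q ` s \<inter> p' v = q ` (s \<inter> P)"
          using s by (auto simp: P_def nest_index_def)
        also have "card \<dots> = card (s \<inter> P)"
          by (rule card_image) (auto intro!: inj_on_subset[OF nestD(2)] simp: P_def)
        finally show ?thesis .
      qed
      show ?thesis
      proof (cases "w \<in> q ` {1..n}")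
        case True
        then obtain k where k: "k \<in> {1..n}" "w = q k" by blast
        have "g s \<in> neighbours H w \<longleftrightarrow> k \<in> s" if s: "s \<in> nest_index n" for s
        proof -
          have "g s \<in> verts D" using s out by (auto simp: S_def)
          then have "g s \<in> neighbours H w \<longleftrightarrow> q k \<in> neighbours D (g s)"
            using w k neighbours_sym[of "g s" D "q k"] neighbours_sym[of "q k" D "g s"] by auto
          also have "\<dots> \<longleftrightarrow> k \<in> s"
            using k s nestD(8)[OF s] inj_on_image_mem_iff[OF nestD(2), of k s]
            by (auto simp: nest_index_def)
          finally show ?thesis .
        qed
        then have "neighbours H w \<inter> S \<inter> p' v = g ` {s \<in> nest_index n. k \<in> s \<and> odd (card (s \<inter> P))}"
          using mem by (auto simp: S_def)
        \<comment> \<open>Membership of \<open>k\<close> excludes the empty index, so the count may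
          range over the whole power set.\<close>
        moreover have "{s \<in> nest_index n. k \<in> s \<and> odd (card (s \<inter> P))}
            = {s \<in> Pow {1..n}. k \<in> s \<and> odd (card (s \<inter> P))}"
          by (auto simp: nest_index_def)
        moreover have "card (g ` {s \<in> nest_index n. k \<in> s \<and> odd (card (s \<inter> P))})
            = card {s \<in> nest_index n. k \<in> s \<and> odd (card (s \<inter> P))}"
          by (rule card_image) (auto intro!: inj_on_subset[OF nestD(3)])
        ultimately show ?thesis using even_card_odd_intersection[of "{1..n}" k P] False by simp
      next
        case False
        have "g s \<notin> neighbours H w" if s: "s \<in> nest_index n" for s
        proof
          assume "g s \<in> neighbours H w"
          then have "w \<in> neighbours D (g s)" using w neighbours_sym[of w D "g s"] by simp
          with s False show False using nestD(8)[OF s] by (auto simp: nest_index_def)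
        qed
        then have "neighbours H w \<inter> S \<inter> p' v = {}" by (auto simp: S_def)
        then show ?thesis by simp
      qed
    qed
  qed
  have "pauli_flow (remove_vertices H S) (\<lambda>v. p' v - S)"
    by (rule pauli_flow_remove_vertices[OF p'(1)], rule odd_nbhd_remove_vertices) (use even in auto)
  then show ?thesis
    by (auto simp: H_def remove_vertices_relabel pauli_flow_relabel_outside S_def)
qed

section \<open>Extended causal flow\<close>

lemma odd_nbhd_singleton:
  "odd_nbhd G {x} = {w \<in> verts G. x \<in> neighbours G w}"
  by (auto simp: odd_nbhd_def Int_insert_right split: if_splits)

text \<open>If a correction set \<open>{f v}\<close> of a qubit \<open>v = q k\<close> were a gadget, then every gadget reached
  from \<open>v\<close> and adjacent to \<open>v\<close> would have label \<open>XY\<close> and would be corrected by a qubit of its own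
  other than \<open>v\<close>; this is impossible for the gadgets at \<open>{j, k}\<close>, \<open>{j, k, l}\<close> and \<open>{k, l}\<close>.\<close>

lemma extended_causal_flow_avoids_nest:
  assumes wf: "wf_diagram D" and nest: "full_spider_nest D n (2 * pi) q g"
    and GD: "corresponds G D" and f: "extended_causal_flow G f"
    and v: "v \<in> non_outputs G - g ` nest_index n"
  shows "f v \<notin> g ` nest_index n"
proof
  define S where "S = g ` nest_index n"
  define R where "R = flow_rel G (\<lambda>v. {f v})"
  note nestD = full_spider_nestD[OF wf nest, folded S_def]
  note G = corresponds_simps[OF GD]
  have irr: "(x, x) \<notin> R\<^sup>+" for x
    using f by (auto simp: extended_causal_flow_def generates_strict_order_def R_def irrefl_def)
  have lab: "lab G x \<in> {MXY, MYZ}" if "x \<in> non_outputs G" for x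
    using f that by (auto simp: extended_causal_flow_def)
  have f_XY: "f x \<in> neighbours G x" if "x \<in> non_outputs G" "lab G x = MXY" for x
    using f that by (auto simp: extended_causal_flow_def)
  have f_YZ: "f x = x" if "x \<in> non_outputs G" "lab G x = MYZ" for x
    using f that by (auto simp: extended_causal_flow_def)
  \<comment> \<open>As only \<open>MXY\<close> and \<open>MYZ\<close> occur, both membership in
    \<open>{f x}\<close> and adjacency to \<open>f x\<close> create arrows.\<close>
  have R_f: "(x, f x) \<in> R" if "x \<in> non_outputs G" "f x \<noteq> x" for x
    using that f_XY[of x] f_YZ[of x] lab[of x] lab[of "f x"]
    by (auto simp: R_def flow_rel_def non_outputs_def neighbours_def)
  have R_nb: "(x, y) \<in> R" if "x \<in> non_outputs G" "f x \<in> neighbours G y" "y \<in> verts G" "x \<noteq> y" for x y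
    using that lab[of y] by (auto simp: R_def flow_rel_def odd_nbhd_singleton non_outputs_def)
  assume "f v \<in> g ` nest_index n"
  then obtain t where t: "t \<in> nest_index n" "f v = g t" by blast
  have gS: "g s \<in> non_outputs G" "g s \<in> verts G" if "s \<in> nest_index n" for s
    using that nestD(5) by (auto simp: S_def G non_outputs_def)
  have nb: "neighbours G (g s) = q ` s" if "s \<in> nest_index n" for s
    using nestD(8)[OF that] by (simp add: G)
  have fv: "f v \<noteq> v" using v t by auto
  have vG: "v \<in> non_outputs G" "v \<in> verts G" using v by (auto simp: non_outputs_def)
  have "lab G v = MXY" using f_YZ[of v] lab[of v] vG fv by auto
  then have "v \<in> neighbours G (g t)"
    using f_XY[of v] vG t neighbours_sym[of v G "g t"] by simp
  then obtain k where k: "k \<in> t" "v = q k" using nb[OF t(1)] by auto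
  have k_n: "k \<in> {1..n}" using k t(1) by (auto simp: nest_index_def)
  have nb_q: "g s \<in> neighbours G (q i)" if "s \<in> nest_index n" "i \<in> s" for s i
    using nb[OF that(1)] that gS(2)[OF that(1)] neighbours_sym[of "g s" G "q i"] by auto
  have q_verts: "q i \<in> verts G" if "i \<in> {1..n}" for i
    using that nest by (auto simp: full_spider_nest_def G)
  \<comment> \<open>These index the gadgets at \<open>v\<close> that lie above \<open>v\<close> in
    the order. They turn out to need pairwise different correcting qubits, none of them
    \<open>v\<close>.\<close>
  define A where "A = {a \<in> nest_index n. k \<in> a \<and> (v, g a) \<in> R\<^sup>+}"
  have tA: "t \<in> A" using R_f[OF vG(1) fv] t k by (auto simp: A_def)
  have A_XY: "lab G (g a) = MXY" if "a \<in> A" for a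
  proof (rule ccontr)
    have a: "a \<in> nest_index n" "k \<in> a" "(v, g a) \<in> R\<^sup>+" using that by (auto simp: A_def)
    assume "lab G (g a) \<noteq> MXY"
    then have "f (g a) = g a" using lab[of "g a"] f_YZ[of "g a"] gS(1)[OF a(1)] by auto
    \<comment> \<open>A gadget that corrects itself precedes its neighbour \<open>v\<close>.\<close>
    then have "(g a, v) \<in> R" using R_nb[of "g a" v] gS[OF a(1)] vG nb_q[OF a(1,2)] k(2) v a(1) by (metis DiffD2 imageI)
    with a(3) show False using irr by (meson trancl.trancl_into_trancl)
  qed
  have A_f: "\<exists>j \<in> a. j \<noteq> k \<and> f (g a) = q j" if "a \<in> A" for a
  proof -
    have a: "a \<in> nest_index n" "k \<in> a" "(v, g a) \<in> R\<^sup>+" using that by (auto simp: A_def)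
    then have "f (g a) \<in> q ` a"
      using f_XY[of "g a"] A_XY[OF that] gS nb by auto
    then obtain j where j: "j \<in> a" "f (g a) = q j" by blast
    have "j \<in> {1..n}" using j a by (auto simp: nest_index_def)
    then have "q j \<noteq> g a" using nestD(4) a(1) unfolding S_def by (metis disjoint_iff imageI)
    then have "(g a, q j) \<in> R" using R_f[of "g a"] gS a j by auto
    then have "q j \<noteq> v" using a(3) irr by (meson trancl.trancl_into_trancl)
    then have "j \<noteq> k" using k(2) by auto
    with j show ?thesis by blast
  qed
  have A_R: "(g a, g b) \<in> R" if "a \<in> A" "b \<in> nest_index n" "j \<in> b" "f (g a) = q j" "a \<noteq> b" for a b j
  proof (rule R_nb)
    have a: "a \<in> nest_index n" using that by (auto simp: A_def)
    then show "g a \<in> non_outputs G" "g b \<in> verts G" using gS that by auto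
    show "g a \<noteq> g b" using a that nestD(3) by (auto dest: inj_onD)
    show "f (g a) \<in> neighbours G (g b)" using that nb by auto
  qed
  have A_step: "b \<in> A" if "a \<in> A" "b \<in> nest_index n" "j \<in> b" "k \<in> b" "f (g a) = q j" for a b j
  proof (cases "a = b")
    case False
    have "(v, g a) \<in> R\<^sup>+" using that by (simp add: A_def)
    then have "(v, g b) \<in> R\<^sup>+"
      using A_R[OF that(1,2,3,5) False] by (rule trancl.trancl_into_trancl)
    then show ?thesis using that by (simp add: A_def)
  qed (use that in simp)
  have A_inj: "a = b" if "a \<in> A" "b \<in> A" "f (g a) = q j" "f (g b) = q j" "j \<in> a" "j \<in> b" for a b j
  proof (rule ccontr)
    assume "a \<noteq> b"
    then have "(g a, g b) \<in> R" "(g b, g a) \<in> R" using A_R that by (auto simp: A_def)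
    then show False using irr by (meson trancl.intros)
  qed
  \<comment> \<open>The label \<open>MXY\<close> does not specialise to \<open>MZ\<close>, so there
    are at least three qubits and a third one \<open>l\<close> is available.\<close>
  have "\<not> n \<le> 2"
    using nest_gadget_label[OF wf nest GD, of "g t"] A_XY[OF tA] t(1)
    by (auto elim: specialises.cases split: if_splits)
  obtain j where j: "j \<in> t" "j \<noteq> k" "f (g t) = q j" using A_f[OF tA] by blast
  have j_n: "j \<in> {1..n}" using j t(1) by (auto simp: nest_index_def)
  have "card {j, k} < card {1..n}" using j(2) \<open>\<not> n \<le> 2\<close> by simp
  then have "\<not> {1..n} \<subseteq> {j, k}" using card_mono[of "{j, k}" "{1..n}"] by auto
  then obtain l where l: "l \<in> {1..n}" "l \<noteq> j" "l \<noteq> k" by blast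
  have idx: "{j, k} \<in> nest_index n" "{j, k, l} \<in> nest_index n" "{k, l} \<in> nest_index n"
    using j_n k_n l by (auto simp: nest_index_def)
  have "{j, k} \<in> A" using A_step[OF tA idx(1) _ _ j(3)] by simp
  moreover then have jk: "f (g {j, k}) = q j" using A_f by blast
  ultimately have "{j, k, l} \<in> A" using A_step[OF _ idx(2) _ _ jk] by simp
  \<comment> \<open>The qubit \<open>j\<close> is taken by the gadget at \<open>{j, k}\<close>,
    which leaves only \<open>l\<close>.\<close>
  moreover have jkl: "f (g {j, k, l}) = q l"
    using A_f[OF \<open>{j, k, l} \<in> A\<close>] A_inj[OF \<open>{j, k, l} \<in> A\<close> \<open>{j, k} \<in> A\<close> _ jk] l by auto
  ultimately have "{k, l} \<in> A" using A_step[OF _ idx(3) _ _ jkl] by simp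
  then have "f (g {k, l}) = q l" using A_f by blast
  then have "{k, l} = {j, k, l}" using A_inj[OF \<open>{k, l} \<in> A\<close> \<open>{j, k, l} \<in> A\<close> _ jkl] by simp
  with j l show False by auto
qed

lemma extended_causal_flow_remove_vertices:
  assumes wf: "wf_open_graph G" and f: "extended_causal_flow G f"
    and S: "\<And>v. v \<in> non_outputs G - S \<Longrightarrow> f v \<notin> S"
  shows "extended_causal_flow (remove_vertices G S) f"
proof -
  have "flow_rel (remove_vertices G S) (\<lambda>v. {f v}) \<subseteq> flow_rel G (\<lambda>v. {f v})"
  proof (rule flow_rel_remove_vertices)
    fix v
    assume v: "v \<in> non_outputs G - S"
    then have fv: "{f v} - S = {f v}" using S by blast
    moreover have "odd_nbhd (remove_vertices G S) ({f v} - S) = odd_nbhd G {f v} - S"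
    proof (rule odd_nbhd_remove_vertices[OF wf])
      fix w
      have "neighbours G w \<inter> S \<inter> {f v} = {}" using S v by blast
      then show "even (card (neighbours G w \<inter> S \<inter> {f v}))" by simp
    qed
    ultimately show "{f v} = {f v} - S \<and>
        odd_nbhd (remove_vertices G S) {f v} = odd_nbhd G {f v} - S" by simp
  qed
  then have "flow_rel (remove_vertices G S) (\<lambda>v. {f v}) \<subseteq> (flow_rel G (\<lambda>v. {f v}))\<^sup>+" by auto
  then have "generates_strict_order (flow_rel (remove_vertices G S) (\<lambda>v. {f v}))"
    using f by (auto simp: extended_causal_flow_def intro: generates_strict_order_mono)
  moreover have "f v \<in> neighbours (remove_vertices G S) v"
    if "v \<in> non_outputs G - S" "lab G v = MXY" for v
    using that f S by (auto simp: neighbours_remove_vertices extended_causal_flow_def)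
  ultimately show ?thesis using f S by (auto simp: extended_causal_flow_def)
qed

section \<open>Interpretation\<close>

definition true_edges :: "('v, 'b) open_graph_scheme \<Rightarrow> ('v \<Rightarrow> bool) \<Rightarrow> 'v set set" where
  "true_edges D y = {e \<in> edges D. \<forall>u \<in> e. y u}"

text \<open>Since \<open>S\<close> is independent, an edge meeting \<open>S\<close> has exactly one
  end there and is counted at that end.\<close>

lemma card_true_edges:
  assumes wf: "wf_open_graph D" and S: "S \<subseteq> verts D"
    and indep: "\<And>u. u \<in> S \<Longrightarrow> neighbours D u \<inter> S = {}"
  shows "card (true_edges D y) = card {e \<in> true_edges D y. e \<inter> S = {}}
    + (\<Sum>u \<in> S. if y u then card {w \<in> neighbours D u. y w} else 0)"
proof -
  let ?F = "\<lambda>u. {e \<in> true_edges D y. u \<in> e}"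
  have finV: "finite (verts D)" and
    E: "\<And>e. e \<in> edges D \<Longrightarrow> \<exists>u w. e = {u, w} \<and> u \<in> verts D \<and> w \<in> verts D \<and> u \<noteq> w"
    using wf by (auto simp: wf_open_graph_def)
  have finS: "finite S" using S finV finite_subset by blast
  have "edges D \<subseteq> Pow (verts D)" using E by blast
  then have fin: "finite (true_edges D y)"
    using finV by (simp add: true_edges_def finite_subset)
  have "true_edges D y = {e \<in> true_edges D y. e \<inter> S = {}} \<union> (\<Union>u \<in> S. ?F u)" by blast
  then have "card (true_edges D y) = card ({e \<in> true_edges D y. e \<inter> S = {}} \<union> (\<Union>u \<in> S. ?F u))"
    by simp
  also have "\<dots> = card {e \<in> true_edges D y. e \<inter> S = {}} + card (\<Union>u \<in> S. ?F u)"
    using fin finS by (intro card_Un_disjoint) auto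
  also have "card (\<Union>u \<in> S. ?F u) = (\<Sum>u \<in> S. card (?F u))"
  proof (rule card_UN_disjoint[OF finS])
    show "\<forall>u \<in> S. finite (?F u)" using fin by simp
    show "\<forall>u \<in> S. \<forall>u' \<in> S. u \<noteq> u' \<longrightarrow> ?F u \<inter> ?F u' = {}"
    proof (intro ballI impI equals0I)
      fix u u' e
      assume u: "u \<in> S" "u' \<in> S" "u \<noteq> u'" and e: "e \<in> ?F u \<inter> ?F u'"
      then have "e \<in> edges D" "u \<in> e" "u' \<in> e" by (auto simp: true_edges_def)
      with E u(3) have "{u, u'} \<in> edges D" by (metis doubleton_eq_iff empty_iff insert_iff)
      then have "u' \<in> neighbours D u" using u S by (auto simp: neighbours_def)
      with indep u show False by blast
    qed
  qed
  also have "\<dots> = (\<Sum>u \<in> S. if y u then card {w \<in> neighbours D u. y w} else 0)"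
  proof (rule sum.cong[OF refl])
    fix u
    assume "u \<in> S"
    show "card (?F u) = (if y u then card {w \<in> neighbours D u. y w} else 0)"
    proof (cases "y u")
      case True
      have "?F u = (\<lambda>w. {u, w}) ` {w \<in> neighbours D u. y w}" (is "_ = ?f ` ?N")
      proof (intro set_eqI iffI)
        fix e
        assume "e \<in> ?F u"
        then have e: "e \<in> edges D" "u \<in> e" "\<forall>w \<in> e. y w" by (auto simp: true_edges_def)
        with E obtain w where "e = {u, w}" "w \<in> verts D" by (metis empty_iff insert_commute insert_iff)
        with e show "e \<in> ?f ` ?N" by (auto simp: neighbours_def)
      qed (use True in \<open>auto simp: true_edges_def neighbours_def\<close>)
      moreover have "inj_on ?f ?N" by (auto intro!: inj_onI simp: doubleton_eq_iff)
      ultimately show ?thesis using True by (simp add: card_image)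
    next
      case False
      then have "?F u = {}" by (auto simp: true_edges_def)
      then show ?thesis using False by (simp only: card.empty if_False)
    qed
  qed
  finally show ?thesis .
qed

text \<open>The factor that a vertex \<open>u\<close> outside the inputs and outputs contributes when its bit is
  summed over and the bits of its neighbours are fixed.\<close>

definition vertex_factor :: "'v mbqc_diagram \<Rightarrow> ('v \<Rightarrow> bool) \<Rightarrow> 'v \<Rightarrow> complex" where
  "vertex_factor D y u =
     (\<Sum>b \<in> UNIV. (if b then (- 1) ^ card {w \<in> neighbours D u. y w} else 1) * eff D u b)"

text \<open>As the neighbours of \<open>u\<close> lie outside \<open>S\<close>, its factor depends
  on \<open>b\<close> only through \<open>b u\<close>; this lets the sum over \<open>b\<close>
  factorise.\<close>

lemma amplitude_delete_vertices:
  assumes wf: "wf_open_graph D" and S: "S \<subseteq> non_outputs D"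
    and indep: "\<And>u. u \<in> S \<Longrightarrow> neighbours D u \<inter> S = {}"
  shows "amplitude D (\<lambda>v. if v \<in> S then b v else y v) = amplitude (delete_vertices D S) y *
    (\<Prod>u \<in> S. (if b u then (- 1) ^ card {w \<in> neighbours D u. y w} else 1) * eff D u (b u))"
proof -
  let ?y = "\<lambda>v. if v \<in> S then b v else y v"
  have SV: "S \<subseteq> verts D" and fin: "finite (non_outputs D)"
    using S wf by (auto simp: non_outputs_def wf_open_graph_def)
  have finS: "finite S" using S fin finite_subset by blast
  have "{e \<in> true_edges D ?y. e \<inter> S = {}} = true_edges (delete_vertices D S) y"
    by (auto simp: true_edges_def delete_vertices_def)
  moreover have "{w \<in> neighbours D u. ?y w} = {w \<in> neighbours D u. y w}" if "u \<in> S" for u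
    using indep[OF that] by auto
  then have "(\<Sum>u \<in> S. if ?y u then card {w \<in> neighbours D u. ?y w} else 0)
      = (\<Sum>u \<in> S. if b u then card {w \<in> neighbours D u. y w} else 0)"
    by (intro sum.cong refl) simp
  ultimately have "card (true_edges D ?y) = card (true_edges (delete_vertices D S) y)
      + (\<Sum>u \<in> S. if b u then card {w \<in> neighbours D u. y w} else 0)"
    using card_true_edges[OF wf SV indep, of ?y] by simp
  then have "(- 1 :: complex) ^ card (true_edges D ?y) = (- 1) ^ card (true_edges (delete_vertices D S) y)
      * (\<Prod>u \<in> S. (- 1) ^ (if b u then card {w \<in> neighbours D u. y w} else 0))"
    by (simp add: power_add power_sum)
  moreover have "(\<Prod>v \<in> non_outputs D. eff D v (?y v))
      = (\<Prod>v \<in> non_outputs D - S. eff D v (y v)) * (\<Prod>v \<in> S. eff D v (b v))"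
    by (subst prod.subset_diff[OF S fin]) (auto intro!: arg_cong2[where f = "(*)"] prod.cong)
  moreover have "non_outputs (delete_vertices D S) = non_outputs D - S"
    "eff (delete_vertices D S) = eff D"
    by (auto simp: non_outputs_def delete_vertices_def)
  ultimately show ?thesis
    by (simp add: amplitude_def true_edges_def[symmetric] prod.distrib if_distrib[of "(^) (- 1)"] cong: if_cong)
qed

text \<open>Summing over the bits on \<open>S\<close> first gives the product of the vertex factors.
  As it has the same value \<open>c\<close> for every \<open>y\<close>, the deletion only rescales
  the map.\<close>

lemma same_operation_delete_vertices:
  assumes wf: "wf_open_graph D" and S: "S \<subseteq> non_outputs D" "S \<subseteq> non_inputs D"
    and indep: "\<And>u. u \<in> S \<Longrightarrow> neighbours D u \<inter> S = {}"
    and c: "c \<noteq> 0" "\<And>y. (\<Prod>u \<in> S. vertex_factor D y u) = c"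
  shows "same_operation D (delete_vertices D S)"
proof -
  let ?D' = "delete_vertices D S"
  let ?merge = "\<lambda>(y, b) v. if v \<in> S then b v else y v"
  have finS: "finite S"
    using S(1) wf finite_subset by (fastforce simp: non_outputs_def wf_open_graph_def)
  have SV: "S \<subseteq> verts D" using S(1) by (auto simp: non_outputs_def)
  have io: "inputs ?D' = inputs D" "outputs ?D' = outputs D"
    using S by (auto simp: delete_vertices_def non_outputs_def non_inputs_def)
  have inS: "inputs D \<subseteq> verts D - S" "outputs D \<subseteq> verts D - S"
    using S wf by (auto simp: non_outputs_def non_inputs_def wf_open_graph_def)
  have V': "verts ?D' = verts D - S" by (simp add: delete_vertices_def)
  have "interp_ket D x z = c * interp_ket ?D' x z" for x z
  proof -
    let ?Y = "{y \<in> bitstrings (verts D). restrict y (inputs D) = x}"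
    let ?Y' = "{y \<in> bitstrings (verts D - S). restrict y (inputs D) = x}"
    let ?f = "\<lambda>y b u. (if b then (- 1) ^ card {w \<in> neighbours D u. y w} else 1) * eff D u b"
    have factor: "(\<Sum>b \<in> bitstrings S. \<Prod>u \<in> S. ?f y (b u) u) = c" for y
      using prod_sum_PiE[OF finS, of "\<lambda>_. UNIV" "\<lambda>u b. ?f y b u"] c(2)[of y]
      by (simp add: bitstrings_def vertex_factor_def del: UNIV_bool)
    have "interp_ket D x z = (\<Sum>y \<in> ?Y. amplitude D y * ket (restrict y (outputs D)) z)"
      by (simp add: interp_ket_def)
    also have "\<dots> = (\<Sum>yb \<in> ?Y' \<times> bitstrings S.
        amplitude D (?merge yb) * ket (restrict (?merge yb) (outputs D)) z)"
    proof (rule sum.reindex_bij_witness[where i = ?merge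
          and j = "\<lambda>y. (restrict y (verts D - S), restrict y S)"])
      fix y assume y: "y \<in> ?Y"
      show "?merge (restrict y (verts D - S), restrict y S) = y"
        using y SV by (auto simp: bitstrings_def fun_eq_iff PiE_def extensional_def)
      then show "amplitude D (?merge (restrict y (verts D - S), restrict y S)) *
          ket (restrict (?merge (restrict y (verts D - S), restrict y S)) (outputs D)) z
        = amplitude D y * ket (restrict y (outputs D)) z" by simp
      show "(restrict y (verts D - S), restrict y S) \<in> ?Y' \<times> bitstrings S"
        using y inS by (auto simp: bitstrings_def restrict_restrict Int_absorb1)
    next
      fix yb assume yb: "yb \<in> ?Y' \<times> bitstrings S"
      then show "(restrict (?merge yb) (verts D - S), restrict (?merge yb) S) = yb"
        by (auto simp: bitstrings_def fun_eq_iff PiE_def extensional_def split: prod.splits)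
      have "restrict (?merge yb) (inputs D) = restrict (fst yb) (inputs D)"
        using inS by (auto simp: fun_eq_iff split: prod.splits)
      then show "?merge yb \<in> ?Y"
        using yb SV by (auto simp: bitstrings_def PiE_def extensional_def)
    qed
    also have "\<dots> = (\<Sum>(y, b) \<in> ?Y' \<times> bitstrings S.
        (amplitude ?D' y * ket (restrict y (outputs D)) z) * (\<Prod>u \<in> S. ?f y (b u) u))"
    proof (rule sum.cong[OF refl], clarify)
      fix y b :: "'a \<Rightarrow> bool"
      have "restrict (\<lambda>v. if v \<in> S then b v else y v) (outputs D) = restrict y (outputs D)"
        using inS by (auto simp: fun_eq_iff)
      then show "amplitude D (\<lambda>v. if v \<in> S then b v else y v)
          * ket (restrict (\<lambda>v. if v \<in> S then b v else y v) (outputs D)) z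
        = (amplitude ?D' y * ket (restrict y (outputs D)) z) * (\<Prod>u \<in> S. ?f y (b u) u)"
        using amplitude_delete_vertices[OF wf S(1) indep, of b y] by simp
    qed
    also have "\<dots> = (\<Sum>y \<in> ?Y'. amplitude ?D' y * ket (restrict y (outputs D)) z *
        (\<Sum>b \<in> bitstrings S. \<Prod>u \<in> S. ?f y (b u) u))"
      by (simp add: sum.cartesian_product[symmetric] sum_distrib_left)
    also have "\<dots> = c * interp_ket ?D' x z"
      unfolding factor by (simp add: interp_ket_def io V' sum_distrib_left mult_ac)
    finally show ?thesis .
  qed
  then have "interp D \<psi> z = c * interp ?D' \<psi> z" for \<psi> z
    by (simp add: interp_def io sum_distrib_left mult_ac)
  then show ?thesis using c(1) io by (auto simp: same_operation_def)
qed

section \<open>The phases of the nest\<close>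

lemma vertex_factor_phase_gadget:
  assumes "proportional (eff D u) (effect_YZ \<alpha>)"
  obtains c where "c \<noteq> 0"
    "\<And>y. vertex_factor D y u = c * (if odd (card {w \<in> neighbours D u. y w}) then cis \<alpha> else 1)"
proof -
  obtain a where a: "a \<noteq> 0" "\<And>b. eff D u b = a * effect_YZ \<alpha> b"
    using assms by (auto simp: proportional_def)
  \<comment> \<open>The sum over the bit pairs the effect with sqrt 2 times the plus or the minus
    state, according to the parity.\<close>
  have "vertex_factor D y u = (a * (2 / sqrt 2)) *
      (if odd (card {w \<in> neighbours D u. y w}) then cis \<alpha> else 1)" for y
    by (simp add: vertex_factor_def UNIV_bool a(2) effect_YZ_def bra_plus_def bra_minus_def
        bra_zero_def bra_one_def cis_conv_exp field_simps)
  then show ?thesis using that[of "a * (2 / sqrt 2)"] a(1) by simp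
qed

text \<open>Each summand is a product over \<open>s\<close> of 1 on \<open>Y\<close> and -1
  elsewhere, so the sum is the expansion of a product over \<open>A\<close> with factors 1 + 1 or -1
  + 1.\<close>

lemma sum_Pow_signs:
  fixes A Y :: "'a set"
  assumes "finite A"
  shows "(\<Sum>s \<in> Pow A. (- 1 :: real) ^ card s * (- 1) ^ card (s \<inter> Y))
    = (if A \<subseteq> Y then 2 ^ card A else 0)"
proof -
  have "(- 1 :: real) ^ card s * (- 1) ^ card (s \<inter> Y) = (\<Prod>i \<in> s. if i \<in> Y then 1 else - 1)"
    if "s \<subseteq> A" for s
  proof -
    have s: "finite s" using assms that finite_subset by blast
    have "(\<Prod>i \<in> s. if i \<in> Y then 1 else - 1 :: real) = (\<Prod>i \<in> s. - 1 * (if i \<in> Y then - 1 else 1))"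
      by (rule prod.cong) auto
    also have "\<dots> = (- 1) ^ card s * (- 1) ^ card (s \<inter> Y)"
      unfolding prod.distrib using prod.inter_restrict[OF s, of "\<lambda>_. - 1 :: real" Y] by simp
    finally show ?thesis by simp
  qed
  then have "(\<Sum>s \<in> Pow A. (- 1 :: real) ^ card s * (- 1) ^ card (s \<inter> Y))
      = (\<Sum>s \<in> Pow A. (\<Prod>i \<in> s. if i \<in> Y then 1 else - 1) * (\<Prod>i \<in> A - s. 1))"
    by (intro sum.cong) auto
  also have "\<dots> = (\<Prod>i \<in> A. (if i \<in> Y then 1 else - 1) + 1)"
    by (rule prod_add[OF assms, symmetric])
  also have "\<dots> = (\<Prod>i \<in> A. if i \<in> Y then 2 else 0)" by (rule prod.cong) auto
  also have "\<dots> = (if A \<subseteq> Y then 2 ^ card A else 0)"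
  proof (cases "A \<subseteq> Y")
    case True
    then have "(\<Prod>i \<in> A. if i \<in> Y then 2 else 0 :: real) = (\<Prod>i \<in> A. 2)"
      by (intro prod.cong) auto
    then show ?thesis using True by simp
  next
    case False
    then show ?thesis using assms by (auto simp: subset_iff)
  qed
  finally show ?thesis .
qed

lemma sum_nest_phases:
  assumes "n \<ge> 1"
  shows "(\<Sum>s \<in> nest_index n.
      if odd (card (s \<inter> Y)) then (- 1) ^ (card s - 1) * (\<phi> / 2 ^ (n - 1)) else 0)
    = (if {1..n} \<subseteq> Y then \<phi> else 0 :: real)"
proof -
  \<comment> \<open>Oddness of m has the indicator (1 - (-1)^m) / 2, whose denominator turns 2^(n-1)
    into 2^n. The intersection with \<open>{}\<close> writes 1 in the form that
    \<open>sum_Pow_signs\<close> expects.\<close>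
  have "(if odd (card (s \<inter> Y)) then (- 1) ^ (card s - 1) * (\<phi> / 2 ^ (n - 1)) else 0)
      = ((- 1) ^ card s * (- 1) ^ card (s \<inter> Y) - (- 1) ^ card s * (- 1) ^ card (s \<inter> {})) * (\<phi> / 2 ^ n)"
    if "s \<in> nest_index n" for s
  proof -
    \<comment> \<open>This matters because the subtraction in \<open>card s - 1\<close> is truncated
      at 0.\<close>
    have "card s \<noteq> 0" using that finite_subset[of s "{1..n}"] by (auto simp: nest_index_def)
    then have "(- 1 :: real) ^ card s = - ((- 1) ^ (card s - 1))" by (cases "card s") auto
    moreover have "(2 :: real) ^ n = 2 * 2 ^ (n - 1)" using assms by (cases n) auto
    ultimately show ?thesis by (simp add: field_simps)
  qed
  then have "(\<Sum>s \<in> nest_index n.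
      if odd (card (s \<inter> Y)) then (- 1) ^ (card s - 1) * (\<phi> / 2 ^ (n - 1)) else 0)
    = (\<Sum>s \<in> nest_index n.
      ((- 1) ^ card s * (- 1) ^ card (s \<inter> Y) - (- 1) ^ card s * (- 1) ^ card (s \<inter> {})) * (\<phi> / 2 ^ n))"
    by (intro sum.cong) auto
  \<comment> \<open>The term of the empty set is 0.\<close>
  also have "\<dots> = (\<Sum>s \<in> Pow {1..n}.
      ((- 1) ^ card s * (- 1) ^ card (s \<inter> Y) - (- 1) ^ card s * (- 1) ^ card (s \<inter> {})) * (\<phi> / 2 ^ n))"
    by (rule sum.mono_neutral_left) (auto simp: nest_index_def)
  also have "\<dots> = (if {1..n} \<subseteq> Y then \<phi> else 0)"
    unfolding sum_distrib_right[symmetric] sum_subtractf using assms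
    by (subst (1 2) sum_Pow_signs) auto
  finally show ?thesis .
qed

lemma same_operation_remove_nest:
  assumes wf: "wf_diagram D" and nest: "full_spider_nest D n (2 * pi) q g"
  shows "same_operation D (remove_nest D n g)"
proof -
  define \<alpha> where "\<alpha> s = (- 1) ^ (card s - 1) * (2 * pi / 2 ^ (n - 1))" for s :: "nat set"
  note nestD = full_spider_nestD[OF wf nest]
  have "\<exists>c. c \<noteq> 0 \<and> (\<forall>y. vertex_factor D y (g s)
      = c * (if odd (card {w \<in> neighbours D (g s). y w}) then cis (\<alpha> s) else 1))"
    if "s \<in> nest_index n" for s
    using vertex_factor_phase_gadget[OF nestD(9)[OF that]] unfolding \<alpha>_def by metis
  then obtain c where c: "\<And>s. s \<in> nest_index n \<Longrightarrow> c s \<noteq> 0"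
    "\<And>s y. s \<in> nest_index n \<Longrightarrow> vertex_factor D y (g s)
      = c s * (if odd (card {w \<in> neighbours D (g s). y w}) then cis (\<alpha> s) else 1)"
    by metis
  have "finite (nest_index n)" by (simp add: nest_index_def)
  then have c0: "(\<Prod>s \<in> nest_index n. c s) \<noteq> 0" using c(1) by simp
  have "(\<Prod>u \<in> g ` nest_index n. vertex_factor D y u) = (\<Prod>s \<in> nest_index n. c s)" for y
  proof -
    define Y where "Y = {i. y (q i)}"
    have parity: "card {w \<in> neighbours D (g s). y w} = card (s \<inter> Y)" if s: "s \<in> nest_index n" for s
    proof -
      have "{w \<in> neighbours D (g s). y w} = q ` (s \<inter> Y)" using nestD(8)[OF s] by (auto simp: Y_def)
      moreover have "card (q ` (s \<inter> Y)) = card (s \<inter> Y)"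
        using s by (intro card_image inj_on_subset[OF nestD(2)]) (auto simp: nest_index_def)
      ultimately show ?thesis by simp
    qed
    have "(\<Prod>u \<in> g ` nest_index n. vertex_factor D y u) = (\<Prod>s \<in> nest_index n. vertex_factor D y (g s))"
      by (rule prod.reindex_cong[OF nestD(3)]) auto
    also have "\<dots> = (\<Prod>s \<in> nest_index n. c s * cis (if odd (card (s \<inter> Y)) then \<alpha> s else 0))"
      by (rule prod.cong) (auto simp: c(2) parity)
    also have "\<dots> = (\<Prod>s \<in> nest_index n. c s) * cis (\<Sum>s \<in> nest_index n. if odd (card (s \<inter> Y)) then \<alpha> s else 0)"
      unfolding prod.distrib using \<open>finite (nest_index n)\<close>
      by (simp add: cis_conv_exp exp_sum[symmetric] sum_distrib_left)
    \<comment> \<open>The total phase is 2 \<pi> or 0, and both are trivial.\<close>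
    also have "cis (\<Sum>s \<in> nest_index n. if odd (card (s \<inter> Y)) then \<alpha> s else 0) = 1"
      unfolding \<alpha>_def sum_nest_phases[OF nestD(1)] by simp
    finally show ?thesis by simp
  qed
  moreover have "neighbours D u \<inter> g ` nest_index n = {}" if "u \<in> g ` nest_index n" for u
  proof -
    from that obtain s where "s \<in> nest_index n" "u = g s" by blast
    then have "neighbours D u \<subseteq> q ` {1..n}" using nestD(8) by (auto simp: nest_index_def)
    then show ?thesis using nestD(4) by blast
  qed
  moreover have "wf_open_graph D" using wf by (simp add: wf_diagram_def)
  ultimately show ?thesis
    unfolding remove_nest_def using same_operation_delete_vertices nestD(5,6) c0 by blast
qed

theorem lemma28:
  fixes D D' :: "'v mbqc_diagram" and n :: nat
    and q :: "nat \<Rightarrow> 'v" and g :: "nat set \<Rightarrow> 'v"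
  assumes "wf_diagram D"
    and "full_spider_nest D n (2 * pi) q g"
    and "D' = remove_nest D n g"
  shows "same_operation D D' \<and>
    (has_extended_causal_flow D \<longrightarrow> has_extended_causal_flow D') \<and>
    (has_gflow D \<longrightarrow> has_gflow D') \<and>
    (has_pauli_flow D \<longrightarrow> has_pauli_flow D')"
proof (intro conjI impI)
  let ?S = "g ` nest_index n"
  have D': "D' = delete_vertices D ?S" using assms(3) by (simp add: remove_nest_def)
  have wf: "wf_open_graph D" using assms(1) by (simp add: wf_diagram_def)
  show "same_operation D D'" using same_operation_remove_nest[OF assms(1,2)] assms(3) by simp
  show "has_extended_causal_flow D'" if "has_extended_causal_flow D"
  proof -
    obtain G f where G: "corresponds G D" "extended_causal_flow G f"
      using \<open>has_extended_causal_flow D\<close> by (auto simp: has_extended_causal_flow_def)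
    then have "extended_causal_flow (remove_vertices G ?S) f"
      using extended_causal_flow_avoids_nest[OF assms(1,2) G] wf
      by (intro extended_causal_flow_remove_vertices) (auto simp: corresponds_simps)
    then show ?thesis
      using corresponds_remove_vertices[OF G(1)] by (auto simp: has_extended_causal_flow_def D')
  qed
  show "has_gflow D'" if "has_gflow D"
  proof -
    obtain G p where G: "corresponds G D" "lab G ` non_outputs G \<subseteq> planar" "pauli_flow G p"
      using \<open>has_gflow D\<close> by (auto simp: has_gflow_def gflow_def)
    then obtain p' where "pauli_flow (remove_vertices G ?S) p'"
      using pauli_flow_remove_nest[OF assms(1,2)] by blast
    then have "gflow (remove_vertices G ?S) p'" using G(2) by (auto simp: gflow_def)
    then show ?thesis using corresponds_remove_vertices[OF G(1)] by (auto simp: has_gflow_def D')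
  qed
  show "has_pauli_flow D'" if "has_pauli_flow D"
  proof -
    obtain G p where G: "max_pauli_corresponds G D" "pauli_flow G p"
      using \<open>has_pauli_flow D\<close> by (auto simp: has_pauli_flow_def)
    then have "corresponds G D" by (simp add: max_pauli_corresponds_def)
    then obtain p' where "pauli_flow (remove_vertices G ?S) p'"
      using pauli_flow_remove_nest[OF assms(1,2)] G(2) by blast
    then show ?thesis
      using max_pauli_corresponds_remove_vertices[OF wf G(1)] by (auto simp: has_pauli_flow_def D')
  qed
qed

end
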